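(* Let $\xi=\{\xi_\nu\}_{\nu=1}^r$ be a finite sample set of points of $\Omega$ and let $f\in V_{M,\Omega}$. Assume that for some $\sigma>0$ the function $h(f)$ satisfies $$\frac{1}{\mu(\Omega)}\|h(f)\|_{L^p(\Omega)}^p-\sigma\le\|S(h(f),\xi)\|_p^p\le\frac{1}{\mu(\Omega)}\|h(f)\|_{L^p(\Omega)}^p+\sigma .$$ Then $$C_1(a)^p\Big(\frac{C_2(a)^{-p}}{\mu(\Omega)}\|f\|_{L^p(\Omega)}^p-(1+a)^{pj_0}-\sigma\Big)\le\|S(f,\xi)\|_p^p\le C_2(a)^p\Big(\frac{C_1(a)^{-p}}{\mu(\Omega)}\|f\|_{L^p(\Omega)}^p+(1+a)^{pj_0}+\sigma\Big).$$
   Context: Let $1\le p<\infty$; $\mu$ is Lebesgue measure on $\mathbb{R}^n$; functions are real-valued. A set $U\subset\mathbb{R}^n$ is relatively separated if $\inf_{u\ne u'\in U}\|u-u'\|_\infty>0$. The Wiener amalgam space $W(L^1)(\mathbb{R}^n)$ consists of all $f\in L^\infty(\mathbb{R}^n)$ with $\|f\|_{W(L^1)(\mathbb{R}^n)}:=\sum_{k\in\mathbb{Z}^n}\sup_{x\in[0,1]^n}|f(x+k)|<\infty$. Setting: $W\subseteq L^2(\mathbb{R}^n)$ is a localizable reproducing kernel Hilbert space, i.e. a closed subspace for which there exist a relatively separated set $\Gamma\subseteq\mathbb{R}^n$, a function $\Theta\in W(L^1)(\mathbb{R}^n)$, and a collection of continuous functions $\{F_\gamma\}_{\gamma\in\Gamma}$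 which is a frame for $W$ and satisfies $|F_\gamma(x)|\le\Theta(x-\gamma)$ for all $\gamma\in\Gamma$, $x\in\mathbb{R}^n$. Put $V:=\{\sum_{\gamma\in\Gamma}c_\gamma F_\gamma: (c_\gamma)\in\ell^p(\Gamma)\}$, a closed subspace of $L^p(\mathbb{R}^n)$. Standing assumptions: $\Omega\subset\mathbb{R}^n$ is compact with $\mu(\Omega)\ge1$; $d$ is the number of unit cubes of the form $m+[0,1]^n$, $m\in\mathbb{Z}^n$, that cover the boundary of $\Omega$; the number of points of $\Gamma$ in $\Omega$ is at most $C(\Gamma)\mu(\Omega)$ for a positive constant $C(\Gamma)$. For every $N>0$, with $C_N=[-N/2,N/2]^n$, $\sum_{k\in\mathbb{Z}^n\setminus C_N}\sup_{x\in[0,1]^n}|\Theta(x-k)|<C N^{-n\alpha}$, where $C>0$ is a constant, $\alpha\ge\frac{p}{p-1}$ if $1<p<\infty$, and $\alpha\ge1$ if $p=1$. Finite-dimensional objects: $M\subset\mathbb{R}^n$ is a compact set, $V_M:=\{\sum_{\gamma\in\Gamma\cap M}c_\gamma F_\gamma: c_\gamma\in\mathbb{R}\}$ and $V_{M,\Omega}:=\{f\in V_M:\|f\|_{L^p(\mathbb{R}^n)}^p=\mu(\Omega)\}$, which is a compact subset of $L^\infty(\mathbb{R}^n)$. Discretization: $C_1(a):=1-a$, $C_2(a):=(1+a)^2$, where $a\in(0,\frac12]$ is fixed with $(C_2(a)/C_1(a))^p\le\frac54$, and $j_0\in\mathbb{Z}$ is fixed. For a compact subset $K$ of a Banach space $X$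 and $\epsilon>0$, $\mathcal{N}_\epsilon(K,X)$ denotes a minimal $\epsilon$-net, i.e. a set $\{f_1,\dots,f_k\}\subseteq K$ of minimal cardinality such that $K$ is covered by the balls of radius $\epsilon$ centred at $f_1,\dots,f_k$. For $j\in\mathbb{Z}$ let $\mathcal{A}_j:=\mathcal{N}_{a(1+a)^j}(V_{M,\Omega},L^\infty(\mathbb{R}^n))$, and for $j\ge j_0$ let $A_j:V_{M,\Omega}\to\mathcal{A}_j$ be a map sending $f$ to an element of $\mathcal{A}_j$ closest to $f$ in $\|\cdot\|_{L^\infty(\mathbb{R}^n)}$ (so $\|f-A_j(f)\|_{L^\infty(\mathbb{R}^n)}\le a(1+a)^j$). For $f\in V_{M,\Omega}$ and $j>j_0$ put $$U_j(f):=\{x\in\mathbb{R}^n:|A_j(f)(x)|\ge(1+a)^j\},\quad D_j(f):=U_j(f)\setminus\bigcup_{k>j}U_k(f),\quad D_{j_0}(f):=\mathbb{R}^n\setminus\bigcup_{k>j_0}U_k(f),$$ and $h(f):=\sum_{j>j_0}(1+a)^j\chi_{D_j(f)}$, where $\chi_E$ is the characteristic function of $E$. Sampling notation: for a function $g$ and $\xi=\{\xi_\nu\}_{\nu=1}^r$, $S(g,\xi):=(g(\xi_1),\dots,g(\xi_r))$ and $\|S(g,\xi)\|_p^p:=\frac1r\sum_{\nu=1}^r|g(\xi_\nu)|^p$. *)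

theory Defs
  imports "HOL-Analysis.Analysis" "HOL-Probability.Essential_Supremum"
begin

section \<open>Lebesgue spaces on Euclidean space\<close>

text \<open>
  Elements of Lebesgue spaces are represented by functions. A set of functions that is closed
  with respect to the \<open>L\<^sup>p\<close> seminorm is automatically closed under almost-everywhere equality, so
  closed subspaces of \<open>L\<^sup>p\<close> correspond exactly to such sets of representatives.
\<close>

definition Lp_space :: "real \<Rightarrow> (real ^ 'n \<Rightarrow> real) set" where
  "Lp_space p = {f \<in> borel_measurable lebesgue. integrable lebesgue (\<lambda>x. \<bar>f x\<bar> powr p)}"

definition Lp_norm :: "real \<Rightarrow> (real ^ 'n) set \<Rightarrow> (real ^ 'n \<Rightarrow> real) \<Rightarrow> real" where
  "Lp_norm p E f = (LINT x:E|lebesgue. \<bar>f x\<bar> powr p) powr (1 / p)"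

definition Linf_norm :: "(real ^ 'n \<Rightarrow> real) \<Rightarrow> ereal" where
  "Linf_norm f = esssup lebesgue (\<lambda>x. ereal \<bar>f x\<bar>)"

definition Linf_space :: "(real ^ 'n \<Rightarrow> real) set" where
  "Linf_space = {f \<in> borel_measurable lebesgue. Linf_norm f < \<infinity>}"

definition L2_inner :: "(real ^ 'n \<Rightarrow> real) \<Rightarrow> (real ^ 'n \<Rightarrow> real) \<Rightarrow> real" where
  "L2_inner f g = (LINT x|lebesgue. f x * g x)"

definition closed_subspace_L2 :: "(real ^ 'n \<Rightarrow> real) set \<Rightarrow> bool" where
  "closed_subspace_L2 W \<longleftrightarrow>
     W \<subseteq> Lp_space 2 \<and>
     (\<lambda>x. 0) \<in> W \<and>
     (\<forall>f\<in>W. \<forall>g\<in>W. (\<lambda>x. f x + g x) \<in> W) \<and>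
     (\<forall>c. \<forall>f\<in>W. (\<lambda>x. c * f x) \<in> W) \<and>
     (\<forall>s. \<forall>g\<in>Lp_space 2. (\<forall>k::nat. s k \<in> W) \<longrightarrow>
        (\<lambda>k. Lp_norm 2 UNIV (\<lambda>x. s k x - g x)) \<longlonglongrightarrow> 0 \<longrightarrow> g \<in> W)"

definition frame_for ::
    "(real ^ 'n \<Rightarrow> real) set \<Rightarrow> 'i set \<Rightarrow> ('i \<Rightarrow> real ^ 'n \<Rightarrow> real) \<Rightarrow> bool" where
  "frame_for W \<Gamma> F \<longleftrightarrow>
     (\<forall>\<gamma>\<in>\<Gamma>. F \<gamma> \<in> W) \<and>
     (\<exists>A B. 0 < A \<and> 0 < B \<and> (\<forall>f\<in>W.
        (\<lambda>\<gamma>. (L2_inner f (F \<gamma>))\<^sup>2) summable_on \<Gamma> \<and>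
        A * (Lp_norm 2 UNIV f)\<^sup>2 \<le> (\<Sum>\<^sub>\<infinity>\<gamma>\<in>\<Gamma>. (L2_inner f (F \<gamma>))\<^sup>2) \<and>
        (\<Sum>\<^sub>\<infinity>\<gamma>\<in>\<Gamma>. (L2_inner f (F \<gamma>))\<^sup>2) \<le> B * (Lp_norm 2 UNIV f)\<^sup>2))"

section \<open>Localizable reproducing kernel Hilbert spaces\<close>

text \<open>The infimum is taken in the extended reals, so sets with at most one point qualify.\<close>

definition relatively_separated :: "(real ^ 'n) set \<Rightarrow> bool" where
  "relatively_separated U \<longleftrightarrow>
     0 < (INF (u, u')\<in>{(u, u'). u \<in> U \<and> u' \<in> U \<and> u \<noteq> u'}. ereal (infnorm (u - u')))"

definition int_lattice :: "(real ^ 'n) set" where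
  "int_lattice = {k. \<forall>i. k $ i \<in> \<int>}"

text \<open>
  The suprema in the amalgam norm are genuine pointwise suprema; they and their sum are formed
  in \<^typ>\<open>ennreal\<close>, where both always exist.
\<close>

definition amalgam_norm :: "(real ^ 'n \<Rightarrow> real) \<Rightarrow> ennreal" where
  "amalgam_norm f = (\<Sum>\<^sub>\<infinity>k\<in>int_lattice. SUP x\<in>cbox 0 1. ennreal \<bar>f (x + k)\<bar>)"

definition wiener_amalgam :: "(real ^ 'n \<Rightarrow> real) set" where
  "wiener_amalgam = {f \<in> Linf_space. amalgam_norm f < \<infinity>}"

definition localizable_rkhs ::
    "(real ^ 'n \<Rightarrow> real) set \<Rightarrow> (real ^ 'n) set \<Rightarrow> (real ^ 'n \<Rightarrow> real) \<Rightarrow>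
     (real ^ 'n \<Rightarrow> real ^ 'n \<Rightarrow> real) \<Rightarrow> bool" where
  "localizable_rkhs W \<Gamma> \<Theta> F \<longleftrightarrow>
     closed_subspace_L2 W \<and>
     relatively_separated \<Gamma> \<and>
     \<Theta> \<in> wiener_amalgam \<and>
     (\<forall>\<gamma>\<in>\<Gamma>. continuous_on UNIV (F \<gamma>)) \<and>
     frame_for W \<Gamma> F \<and>
     (\<forall>\<gamma>\<in>\<Gamma>. \<forall>x. \<bar>F \<gamma> x\<bar> \<le> \<Theta> (x - \<gamma>))"

definition amalgam_tail :: "(real ^ 'n \<Rightarrow> real) \<Rightarrow> real \<Rightarrow> ennreal" where
  "amalgam_tail \<Theta> N =
     (\<Sum>\<^sub>\<infinity>k\<in>int_lattice - cbox (vec (- N / 2)) (vec (N / 2)).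
        SUP x\<in>cbox 0 1. ennreal \<bar>\<Theta> (x - k)\<bar>)"

text \<open>
  For relatively separated \<open>\<Gamma>\<close> and compact \<open>M\<close> the index set \<open>\<Gamma> \<inter> M\<close> is finite.
\<close>

definition V_M ::
    "(real ^ 'n) set \<Rightarrow> (real ^ 'n \<Rightarrow> real ^ 'n \<Rightarrow> real) \<Rightarrow> (real ^ 'n) set \<Rightarrow>
     (real ^ 'n \<Rightarrow> real) set" where
  "V_M \<Gamma> F M = {\<lambda>x. \<Sum>\<gamma>\<in>\<Gamma> \<inter> M. c \<gamma> * F \<gamma> x | c. True}"

definition V_M\<Omega> ::
    "real \<Rightarrow> (real ^ 'n) set \<Rightarrow> (real ^ 'n \<Rightarrow> real ^ 'n \<Rightarrow> real) \<Rightarrow> (real ^ 'n) set \<Rightarrow>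
     (real ^ 'n) set \<Rightarrow> (real ^ 'n \<Rightarrow> real) set" where
  "V_M\<Omega> p \<Gamma> F M \<Omega> = {f \<in> V_M \<Gamma> F M. Lp_norm p UNIV f powr p = measure lebesgue \<Omega>}"

section \<open>Minimal nets and the discretization\<close>

definition C1 :: "real \<Rightarrow> real" where "C1 a = 1 - a"

definition C2 :: "real \<Rightarrow> real" where "C2 a = (1 + a)\<^sup>2"

text \<open>The balls in the covering condition are closed.\<close>

definition Linf_net ::
    "real \<Rightarrow> (real ^ 'n \<Rightarrow> real) set \<Rightarrow> (real ^ 'n \<Rightarrow> real) set \<Rightarrow> bool" where
  "Linf_net \<epsilon> K S \<longleftrightarrow>
     finite S \<and> S \<subseteq> K \<and> (\<forall>f\<in>K. \<exists>g\<in>S. Linf_norm (\<lambda>x. f x - g x) \<le> ereal \<epsilon>)"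

definition minimal_Linf_net ::
    "real \<Rightarrow> (real ^ 'n \<Rightarrow> real) set \<Rightarrow> (real ^ 'n \<Rightarrow> real) set \<Rightarrow> bool" where
  "minimal_Linf_net \<epsilon> K S \<longleftrightarrow> Linf_net \<epsilon> K S \<and> (\<forall>T. Linf_net \<epsilon> K T \<longrightarrow> card S \<le> card T)"

definition U_set ::
    "real \<Rightarrow> (int \<Rightarrow> (real ^ 'n \<Rightarrow> real) \<Rightarrow> real ^ 'n \<Rightarrow> real) \<Rightarrow> int \<Rightarrow>
     (real ^ 'n \<Rightarrow> real) \<Rightarrow> (real ^ 'n) set" where
  "U_set a A j f = {x. (1 + a) powi j \<le> \<bar>A j f x\<bar>}"

definition D_set ::
    "real \<Rightarrow> int \<Rightarrow> (int \<Rightarrow> (real ^ 'n \<Rightarrow> real) \<Rightarrow> real ^ 'n \<Rightarrow> real) \<Rightarrow> int \<Rightarrow>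
     (real ^ 'n \<Rightarrow> real) \<Rightarrow> (real ^ 'n) set" where
  "D_set a j\<^sub>0 A j f =
     (if j = j\<^sub>0 then UNIV else U_set a A j f) - (\<Union>k\<in>{j<..}. U_set a A k f)"

text \<open>
  The sets \<open>D_set a j\<^sub>0 A j f\<close> for \<open>j > j\<^sub>0\<close> are pairwise disjoint, so at every point at most one
  term of the following sum is nonzero.
\<close>

definition h_fun ::
    "real \<Rightarrow> int \<Rightarrow> (int \<Rightarrow> (real ^ 'n \<Rightarrow> real) \<Rightarrow> real ^ 'n \<Rightarrow> real) \<Rightarrow>
     (real ^ 'n \<Rightarrow> real) \<Rightarrow> real ^ 'n \<Rightarrow> real" where
  "h_fun a j\<^sub>0 A f x =
     (\<Sum>\<^sub>\<infinity>j\<in>{j\<^sub>0<..}. (1 + a) powi j * indicator (D_set a j\<^sub>0 A j f) x)"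

section \<open>Sampling\<close>

definition sample :: "(real ^ 'n \<Rightarrow> real) \<Rightarrow> (real ^ 'n) list \<Rightarrow> real list" where
  "sample g \<xi> = map g \<xi>"

definition sample_norm :: "real \<Rightarrow> real list \<Rightarrow> real" where
  "sample_norm p ys = (1 / real (length ys) * (\<Sum>y\<leftarrow>ys. \<bar>y\<bar> powr p)) powr (1 / p)"

end

theory Submission
  imports Defs
begin

text \<open>
  On \<open>D\<^sub>j(f)\<close> with \<open>j > j\<^sub>0\<close>, where \<open>h(f) = (1 + a) powi j\<close>, membership in \<open>U\<^sub>j(f)\<close> bounds \<open>\<bar>f\<bar>\<close> from
  below and non-membership in \<open>U\<^sub>j\<^sub>+\<^sub>1(f)\<close> bounds it from above; on the complement of these sets, where
  \<open>h(f) = 0\<close>, only the upper bound survives. Hence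
  \<open>C\<^sub>1(a) h(f) \<le> \<bar>f\<bar> \<le> C\<^sub>2(a) max (h(f)) ((1 + a) powi j\<^sub>0)\<close> pointwise. Raising this to the
  power \<open>p\<close> and averaging, once over \<open>\<xi>\<close> and once over \<open>\<Omega>\<close>, turns the hypothesis on \<open>h(f)\<close> into the
  conclusion on \<open>f\<close>. Since \<open>\<xi>\<close> is a null set, the \<open>L\<^sup>\<infinity>\<close> estimates have to hold at every point,
  which they do because the functions involved are continuous.
\<close>

section \<open>From essential suprema to bounds at every point\<close>

lemma continuous_abs_le_of_Linf_norm:
  fixes g :: "real ^ 'n \<Rightarrow> real"
  assumes g: "continuous_on UNIV g" and le: "Linf_norm g \<le> ereal c"
  shows "\<bar>g x\<bar> \<le> c"
proof (rule ccontr)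
  assume "\<not> \<bar>g x\<bar> \<le> c"
  then have x: "x \<in> {y. c < \<bar>g y\<bar>}"
    by simp
  \<comment> \<open>The set where the bound fails is open by continuity and null by the essential
    bound. A nonempty open set is not negligible, so it cannot contain \<open>x\<close>.\<close>
  have op: "open {y. c < \<bar>g y\<bar>}"
    by (intro open_Collect_less continuous_intros g)
  have "AE y in lebesgue. ereal \<bar>g y\<bar> \<le> esssup lebesgue (\<lambda>y. ereal \<bar>g y\<bar>)"
    by (rule esssup_AE)
  then have "AE y in lebesgue. y \<notin> {y. c < \<bar>g y\<bar>}"
  proof eventually_elim
    case (elim y)
    then have "ereal \<bar>g y\<bar> \<le> ereal c"
      using le unfolding Linf_norm_def by (rule order_trans)
    then show ?case by simp
  qed
  moreover have "{y. c < \<bar>g y\<bar>} \<in> sets lebesgue"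
    using op by (intro sets_completionI_sets) simp
  ultimately have "{y. c < \<bar>g y\<bar>} \<in> null_sets lebesgue"
    by (subst AE_iff_null_sets) auto
  then have "negligible {y. c < \<bar>g y\<bar>}"
    by (simp add: negligible_iff_null_sets)
  with open_not_negligible[OF op] x show False
    by blast
qed

lemma V_M_continuous_on:
  assumes "\<And>\<gamma>. \<gamma> \<in> \<Gamma> \<Longrightarrow> continuous_on UNIV (F \<gamma>)" and "g \<in> V_M \<Gamma> F M"
  shows "continuous_on UNIV g"
  using assms unfolding V_M_def by (auto intro!: continuous_intros)

section \<open>The level sets and the pointwise comparison of \<open>f\<close> with its
  discretization\<close>

lemma D_set_disjoint:
  assumes "j \<noteq> k" "j\<^sub>0 \<le> j" "j\<^sub>0 \<le> k" "x \<in> D_set a j\<^sub>0 A j f"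
  shows "x \<notin> D_set a j\<^sub>0 A k f"
  using assms by (cases j k rule: linorder_cases) (auto simp: D_set_def split: if_splits)

lemma h_fun_eq_on_D_set:
  assumes "j\<^sub>0 \<le> j" "x \<in> D_set a j\<^sub>0 A j f"
  shows "h_fun a j\<^sub>0 A f x = (if j = j\<^sub>0 then 0 else (1 + a) powi j)"
proof -
  have zero: "x \<notin> D_set a j\<^sub>0 A k f" if "k \<noteq> j" "j\<^sub>0 < k" for k
    using D_set_disjoint[OF that(1)[symmetric] assms(1) _ assms(2)] that(2) by simp
  \<comment> \<open>Disjointness leaves at most one nonzero term. The index set
    \<open>{j} - {j\<^sub>0}\<close> is empty when \<open>j = j\<^sub>0\<close>, which gives the
    value 0 there.\<close>
  have "h_fun a j\<^sub>0 A f x =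
      (\<Sum>\<^sub>\<infinity>k\<in>{j} - {j\<^sub>0}. (1 + a) powi k * indicator (D_set a j\<^sub>0 A k f) x)"
    unfolding h_fun_def
    by (rule infsum_cong_neutral) (use assms(1) zero in auto)
  then show ?thesis
    using assms by auto
qed

text \<open>The required level is the largest one above \<open>j\<^sub>0\<close> whose
  \<open>U_set\<close> contains \<open>x\<close>, or \<open>j\<^sub>0\<close> if there is none. A
  largest one exists because membership at level \<open>k\<close> forces
  \<open>(1 - a) * (1 + a) powi k\<close> to be at most the fixed number
  \<open>\<bar>f x\<bar>\<close>, which fails for large \<open>k\<close>.\<close>

lemma D_set_cover:
  assumes a: "0 < a" "a < 1"
    and app: "\<And>j. j\<^sub>0 \<le> j \<Longrightarrow> \<bar>f x - A j f x\<bar> \<le> a * (1 + a) powi j"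
  shows "\<exists>j\<ge>j\<^sub>0. x \<in> D_set a j\<^sub>0 A j f"
proof -
  define S where "S = {k. j\<^sub>0 < k \<and> x \<in> U_set a A k f}"
  obtain N where N: "\<bar>f x\<bar> / (1 - a) < (1 + a) ^ N"
    using real_arch_pow[of "1 + a"] a by auto
  have "k < int N" if "k \<in> S" for k
  proof (rule ccontr)
    assume "\<not> k < int N"
    then have "(1 + a) powi int N \<le> (1 + a) powi k"
      using a by (intro power_int_increasing) auto
    moreover have "\<bar>f x - A k f x\<bar> \<le> a * (1 + a) powi k" "(1 + a) powi k \<le> \<bar>A k f x\<bar>"
      using that app[of k] by (auto simp: S_def U_set_def)
    then have "(1 - a) * (1 + a) powi k \<le> \<bar>f x\<bar>"
      by (simp add: algebra_simps)
    then have "(1 + a) powi k \<le> \<bar>f x\<bar> / (1 - a)"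
      using a by (simp add: field_simps)
    ultimately show False
      using N by simp
  qed
  then have "S \<subseteq> {j\<^sub>0<..<int N}"
    by (auto simp: S_def)
  then have fin: "finite S"
    by (rule finite_subset) simp
  show ?thesis
  proof (cases "S = {}")
    case True
    then have "x \<in> D_set a j\<^sub>0 A j\<^sub>0 f"
      by (auto simp: D_set_def S_def)
    then show ?thesis by blast
  next
    case False
    define m where "m = Max S"
    have "m \<in> S"
      unfolding m_def using fin False by (rule Max_in)
    moreover have "k \<notin> S" if "m < k" for k
      using that Max_ge[OF fin, of k] unfolding m_def by linarith
    ultimately have "x \<in> D_set a j\<^sub>0 A m f" "j\<^sub>0 \<le> m"
      by (fastforce simp: D_set_def S_def)+
    then show ?thesis by blast
  qed
qed

text \<open>The square in \<open>C2\<close> comes from looking one level up: \<open>x\<close> is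
  outside the \<open>U_set\<close> of level \<open>j + 1\<close>, so the approximant there is below
  \<open>(1 + a) powi (j + 1)\<close>, and the error contributes at most \<open>a\<close> times the
  same power.\<close>

lemma abs_less_on_D_set:
  assumes a: "0 < a" and j: "j\<^sub>0 \<le> j" and x: "x \<in> D_set a j\<^sub>0 A j f"
    and app: "\<And>j. j\<^sub>0 \<le> j \<Longrightarrow> \<bar>f x - A j f x\<bar> \<le> a * (1 + a) powi j"
  shows "\<bar>f x\<bar> < C2 a * (1 + a) powi j"
proof -
  have "\<bar>A (j + 1) f x\<bar> < (1 + a) powi (j + 1)"
    using x by (auto simp: D_set_def U_set_def not_le)
  with app[of "j + 1"] j have "\<bar>f x\<bar> < (1 + a) * (1 + a) powi (j + 1)"
    by (simp add: algebra_simps)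
  also have "\<dots> = C2 a * (1 + a) powi j"
    using a by (simp add: C2_def power2_eq_square power_int_add_1')
  finally show ?thesis .
qed

lemma h_fun_bounds:
  assumes a: "0 < a" "a < 1"
    and app: "\<And>j. j\<^sub>0 \<le> j \<Longrightarrow> \<bar>f x - A j f x\<bar> \<le> a * (1 + a) powi j"
  shows "0 \<le> h_fun a j\<^sub>0 A f x" "C1 a * h_fun a j\<^sub>0 A f x \<le> \<bar>f x\<bar>"
    and "\<bar>f x\<bar> \<le> C2 a * max (h_fun a j\<^sub>0 A f x) ((1 + a) powi j\<^sub>0)"
proof -
  obtain j where j: "j\<^sub>0 \<le> j" "x \<in> D_set a j\<^sub>0 A j f"
    using D_set_cover[OF a, of j\<^sub>0 f x A] app by blast
  note h = h_fun_eq_on_D_set[OF j]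
  show "0 \<le> h_fun a j\<^sub>0 A f x"
    using a unfolding h by simp
  have less: "\<bar>f x\<bar> < C2 a * (1 + a) powi j"
    by (rule abs_less_on_D_set[OF a(1) j app])
  \<comment> \<open>At level \<open>j\<^sub>0\<close> the left side is 0. At higher levels
    \<open>A j f x\<close> has size at least \<open>(1 + a) powi j\<close>, and the approximation
    error costs the fraction \<open>a\<close> of it.\<close>
  show "C1 a * h_fun a j\<^sub>0 A f x \<le> \<bar>f x\<bar>"
  proof (cases "j = j\<^sub>0")
    case False
    with j have "(1 + a) powi j \<le> \<bar>A j f x\<bar>"
      by (simp add: D_set_def U_set_def)
    with app[OF j(1)] False show ?thesis
      by (simp add: h C1_def algebra_simps)
  qed (simp add: h)
  \<comment> \<open>The maximum serves both cases: for \<open>j = j\<^sub>0\<close>, where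
    \<open>h_fun\<close> vanishes, the second entry supplies the bound.\<close>
  have "(1 + a) powi j \<le> max (h_fun a j\<^sub>0 A f x) ((1 + a) powi j\<^sub>0)"
    by (simp add: h)
  then have "C2 a * (1 + a) powi j \<le> C2 a * max (h_fun a j\<^sub>0 A f x) ((1 + a) powi j\<^sub>0)"
    by (intro mult_left_mono) (simp_all add: C2_def)
  with less show "\<bar>f x\<bar> \<le> C2 a * max (h_fun a j\<^sub>0 A f x) ((1 + a) powi j\<^sub>0)"
    by simp
qed

lemma h_fun_powr_bounds:
  assumes a: "0 < a" "a < 1" and p: "0 \<le> p"
    and app: "\<And>j. j\<^sub>0 \<le> j \<Longrightarrow> \<bar>f x - A j f x\<bar> \<le> a * (1 + a) powi j"
  shows "C1 a powr p * \<bar>h_fun a j\<^sub>0 A f x\<bar> powr p \<le> \<bar>f x\<bar> powr p"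
    and "\<bar>f x\<bar> powr p \<le>
      C2 a powr p * (\<bar>h_fun a j\<^sub>0 A f x\<bar> powr p + (1 + a) powr (p * real_of_int j\<^sub>0))"
proof -
  let ?h = "h_fun a j\<^sub>0 A f x"
  note b = h_fun_bounds[OF a, of j\<^sub>0 f x A, OF app]
  have "C1 a powr p * \<bar>?h\<bar> powr p = (C1 a * ?h) powr p"
    using a b(1) by (simp add: C1_def powr_mult)
  also have "\<dots> \<le> \<bar>f x\<bar> powr p"
    using a b p by (intro powr_mono2) (auto simp: C1_def)
  finally show "C1 a powr p * \<bar>?h\<bar> powr p \<le> \<bar>f x\<bar> powr p" .
  have j0: "((1 + a) powi j\<^sub>0) powr p = (1 + a) powr (p * real_of_int j\<^sub>0)"
  proof -
    have "(1 + a) powi j\<^sub>0 = (1 + a) powr real_of_int j\<^sub>0"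
      using a by (intro powr_real_of_int'[symmetric]) auto
    then show ?thesis
      by (simp only: powr_powr mult.commute)
  qed
  have "\<bar>f x\<bar> powr p \<le> (C2 a * max ?h ((1 + a) powi j\<^sub>0)) powr p"
    using b p by (intro powr_mono2) auto
  also have "\<dots> = C2 a powr p * max ?h ((1 + a) powi j\<^sub>0) powr p"
    using a b(1) by (simp add: C2_def powr_mult)
  \<comment> \<open>The power of a maximum is one of the two powers, hence at most their sum; no
    factor depending on \<open>p\<close> is lost.\<close>
  also have "\<dots> \<le> C2 a powr p * (\<bar>?h\<bar> powr p + (1 + a) powr (p * real_of_int j\<^sub>0))"
    using b(1) by (intro mult_left_mono) (auto simp: max_def j0)
  finally show "\<bar>f x\<bar> powr p \<le>
      C2 a powr p * (\<bar>?h\<bar> powr p + (1 + a) powr (p * real_of_int j\<^sub>0))" .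
qed

text \<open>The function is constant on each of the countably many Borel sets
  \<open>D_set a j\<^sub>0 A j f\<close>, and these cover the space.\<close>

lemma h_fun_borel_measurable:
  assumes a: "0 < a" "a < 1"
    and app: "\<And>j x. j\<^sub>0 \<le> j \<Longrightarrow> \<bar>f x - A j f x\<bar> \<le> a * (1 + a) powi j"
    and meas: "\<And>j. j\<^sub>0 \<le> j \<Longrightarrow> A j f \<in> borel_measurable borel"
  shows "h_fun a j\<^sub>0 A f \<in> borel_measurable borel"
proof (rule measurable_piecewise_restrict)
  let ?C = "(\<lambda>j. D_set a j\<^sub>0 A j f) ` {j\<^sub>0..}"
  show "countable ?C"
    by (intro countable_image countableI_type)
  have U: "U_set a A j f \<in> sets borel" if "j\<^sub>0 \<le> j" for j
  proof -
    have [measurable]: "A j f \<in> borel_measurable borel"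
      by (rule meas[OF that])
    have "{x \<in> space borel. (1 + a) powi j \<le> \<bar>A j f x\<bar>} \<in> sets borel"
      by measurable
    then show ?thesis
      by (simp add: U_set_def)
  qed
  fix E
  assume "E \<in> ?C"
  then obtain j where j: "j\<^sub>0 \<le> j" and E: "E = D_set a j\<^sub>0 A j f"
    by blast
  show "E \<inter> space borel \<in> sets borel"
    unfolding E D_set_def using j by (auto intro!: sets.Diff sets.countable_UN' U)
  have "(\<lambda>x. if j = j\<^sub>0 then 0 else (1 + a) powi j) \<in> borel_measurable (restrict_space borel E)"
    by simp
  then show "h_fun a j\<^sub>0 A f \<in> borel_measurable (restrict_space borel E)"
    by (rule measurable_cong[THEN iffD1, rotated])
      (simp add: E space_restrict_space h_fun_eq_on_D_set[OF j])
next
  show "space borel \<subseteq> \<Union> ((\<lambda>j. D_set a j\<^sub>0 A j f) ` {j\<^sub>0..})"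
    using D_set_cover[OF a, of j\<^sub>0 f _ A] app by fastforce
qed

section \<open>Averages of p-th powers and the transfer from \<open>h_fun\<close> to
  \<open>f\<close>\<close>

lemma Lp_norm_powr:
  assumes "1 \<le> p"
  shows "Lp_norm p E g powr p = (LINT x:E|lebesgue. \<bar>g x\<bar> powr p)"
proof -
  have "0 \<le> (LINT x:E|lebesgue. \<bar>g x\<bar> powr p)"
    by (simp add: set_lebesgue_integral_def)
  with assms show ?thesis
    by (simp add: Lp_norm_def powr_powr)
qed

lemma sample_norm_powr:
  assumes "1 \<le> p"
  shows "sample_norm p (sample g \<xi>) powr p = (\<Sum>x\<leftarrow>\<xi>. \<bar>g x\<bar> powr p) / real (length \<xi>)"
proof -
  have "0 \<le> (\<Sum>x\<leftarrow>\<xi>. \<bar>g x\<bar> powr p)"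
    by (rule sum_list_nonneg) auto
  with assms show ?thesis
    by (simp add: sample_norm_def sample_def powr_powr o_def)
qed

lemma set_integrable_lebesgue_compact:
  fixes g :: "real ^ 'n \<Rightarrow> real"
  assumes "compact S" "continuous_on S g"
  shows "set_integrable lebesgue S g"
proof -
  have "integrable lborel (\<lambda>x. indicator S x *\<^sub>R g x)"
    by (rule borel_integrable_compact[OF assms])
  then show ?thesis
    unfolding set_integrable_def by (simp add: integrable_completion)
qed

theorem lemma3p4:
  fixes p C C\<^sub>\<Gamma> \<alpha> a \<sigma> :: real
    and W :: "(real ^ 'n \<Rightarrow> real) set"
    and \<Gamma> \<Omega> M :: "(real ^ 'n) set"
    and \<Theta> :: "real ^ 'n \<Rightarrow> real"
    and F :: "real ^ 'n \<Rightarrow> real ^ 'n \<Rightarrow> real"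
    and j\<^sub>0 :: int
    and Net :: "int \<Rightarrow> (real ^ 'n \<Rightarrow> real) set"
    and A :: "int \<Rightarrow> (real ^ 'n \<Rightarrow> real) \<Rightarrow> real ^ 'n \<Rightarrow> real"
    and \<xi> :: "(real ^ 'n) list"
    and f :: "real ^ 'n \<Rightarrow> real"
  assumes p: "1 \<le> p"
    and W: "localizable_rkhs W \<Gamma> \<Theta> F"
    and \<Omega>: "compact \<Omega>" "1 \<le> measure lebesgue \<Omega>"
    and \<Gamma>: "0 < C\<^sub>\<Gamma>" "real (card (\<Gamma> \<inter> \<Omega>)) \<le> C\<^sub>\<Gamma> * measure lebesgue \<Omega>"
    and \<alpha>: "if p = 1 then 1 \<le> \<alpha> else p / (p - 1) \<le> \<alpha>"
    and C: "0 < C"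
    and \<Theta>: "\<And>N::real. 0 < N \<Longrightarrow>
              amalgam_tail \<Theta> N < ennreal (C * N powr (- (real CARD('n) * \<alpha>)))"
    and M: "compact M"
    and a: "0 < a" "a \<le> 1 / 2" "(C2 a / C1 a) powr p \<le> 5 / 4"
    and Net: "\<And>j. minimal_Linf_net (a * (1 + a) powi j) (V_M\<Omega> p \<Gamma> F M \<Omega>) (Net j)"
    and A: "\<And>j g. j\<^sub>0 \<le> j \<Longrightarrow> g \<in> V_M\<Omega> p \<Gamma> F M \<Omega> \<Longrightarrow>
              A j g \<in> Net j \<and>
              (\<forall>u\<in>Net j. Linf_norm (\<lambda>x. g x - A j g x) \<le> Linf_norm (\<lambda>x. g x - u x))"
    and \<xi>: "\<xi> \<noteq> []" "set \<xi> \<subseteq> \<Omega>"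
    and f: "f \<in> V_M\<Omega> p \<Gamma> F M \<Omega>"
    and \<sigma>: "0 < \<sigma>"
    and h_lower: "1 / measure lebesgue \<Omega> * Lp_norm p \<Omega> (h_fun a j\<^sub>0 A f) powr p - \<sigma>
                    \<le> sample_norm p (sample (h_fun a j\<^sub>0 A f) \<xi>) powr p"
    and h_upper: "sample_norm p (sample (h_fun a j\<^sub>0 A f) \<xi>) powr p
                    \<le> 1 / measure lebesgue \<Omega> * Lp_norm p \<Omega> (h_fun a j\<^sub>0 A f) powr p + \<sigma>"
  shows "C1 a powr p * (C2 a powr (- p) / measure lebesgue \<Omega> * Lp_norm p \<Omega> f powr p
             - (1 + a) powr (p * real_of_int j\<^sub>0) - \<sigma>)
           \<le> sample_norm p (sample f \<xi>) powr p
       \<and> sample_norm p (sample f \<xi>) powr p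
           \<le> C2 a powr p * (C1 a powr (- p) / measure lebesgue \<Omega> * Lp_norm p \<Omega> f powr p
             + (1 + a) powr (p * real_of_int j\<^sub>0) + \<sigma>)"
proof -
  let ?h = "h_fun a j\<^sub>0 A f"
  let ?\<mu> = "measure lebesgue \<Omega>"
  let ?c = "(1 + a) powr (p * real_of_int j\<^sub>0)"
  let ?I = "\<lambda>g. LINT x:\<Omega>|lebesgue. \<bar>g x\<bar> powr p"
  let ?S = "\<lambda>g. (\<Sum>x\<leftarrow>\<xi>. \<bar>g x\<bar> powr p) / real (length \<xi>)"
  have a1: "a < 1" and p0: "0 \<le> p" and \<mu>: "0 < ?\<mu>" and len: "0 < real (length \<xi>)"
    using a p \<Omega>(2) \<xi>(1) by auto
  have C1: "0 < C1 a" and C2: "0 < C2 a"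
    using a by (auto simp: C1_def C2_def)
  have cont: "continuous_on UNIV g" if "g \<in> V_M\<Omega> p \<Gamma> F M \<Omega>" for g
    using that W by (auto simp: V_M\<Omega>_def localizable_rkhs_def intro: V_M_continuous_on)
  \<comment> \<open>The net consists of elements of \<open>V_M\<Omega>\<close>, so the approximants
    are continuous too.\<close>
  have contA: "continuous_on UNIV (A j f)" if "j\<^sub>0 \<le> j" for j
    using A[OF that f] Net[of j] by (auto simp: minimal_Linf_net_def Linf_net_def intro: cont)
  have app: "\<bar>f x - A j f x\<bar> \<le> a * (1 + a) powi j" if j: "j\<^sub>0 \<le> j" for j x
  proof -
    \<comment> \<open>The net provides some \<open>u\<close> within the radius, and the closest
      element \<open>A j f\<close> is at least as near.\<close>
    obtain u where u: "u \<in> Net j" "Linf_norm (\<lambda>x. f x - u x) \<le> ereal (a * (1 + a) powi j)"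
      using Net[of j] f by (auto simp: minimal_Linf_net_def Linf_net_def)
    then have "Linf_norm (\<lambda>x. f x - A j f x) \<le> ereal (a * (1 + a) powi j)"
      using A[OF j f] by (blast intro: order_trans)
    then show ?thesis
      by (rule continuous_abs_le_of_Linf_norm[rotated])
        (intro continuous_intros cont contA f j)
  qed
  have low: "C1 a powr p * \<bar>?h x\<bar> powr p \<le> \<bar>f x\<bar> powr p"
    and upp: "\<bar>f x\<bar> powr p \<le> C2 a powr p * (\<bar>?h x\<bar> powr p + ?c)" for x
    using h_fun_powr_bounds[OF a(1) a1 p0, of j\<^sub>0 f x A] app by blast+
  have int_f: "set_integrable lebesgue \<Omega> (\<lambda>x. \<bar>f x\<bar> powr p)"
  proof (rule set_integrable_lebesgue_compact[OF \<Omega>(1)], rule continuous_on_powr')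
    show "continuous_on \<Omega> (\<lambda>x. \<bar>f x\<bar>)"
      by (intro continuous_intros continuous_on_subset[OF cont[OF f]]) simp
  qed (use p in auto)
  have int_c: "set_integrable lebesgue \<Omega> (\<lambda>x. ?c)"
    by (rule set_integrable_lebesgue_compact[OF \<Omega>(1)]) simp
  \<comment> \<open>The integral of a non-integrable function is 0 by default, so monotonicity needs
    this first. The lower pointwise bound makes a multiple of the p-th power of
    \<open>\<bar>f\<bar>\<close> a dominating function; the latter is continuous on a compact
    set.\<close>
  have int_h: "set_integrable lebesgue \<Omega> (\<lambda>x. \<bar>?h x\<bar> powr p)"
  proof (rule set_integrable_bound)
    show "set_integrable lebesgue \<Omega> (\<lambda>x. C1 a powr (- p) * \<bar>f x\<bar> powr p)"
      using int_f by simp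
    have "?h \<in> borel_measurable borel"
      by (intro h_fun_borel_measurable a(1) a1 app borel_measurable_continuous_onI contA)
    then have [measurable]: "?h \<in> borel_measurable lebesgue"
      by (intro measurable_completion) simp
    have [measurable]: "\<Omega> \<in> sets lebesgue"
      using \<Omega>(1) by (simp add: borel_compact)
    show "set_borel_measurable lebesgue \<Omega> (\<lambda>x. \<bar>?h x\<bar> powr p)"
      unfolding set_borel_measurable_def by measurable
    show "AE x in lebesgue. x \<in> \<Omega> \<longrightarrow>
        norm (\<bar>?h x\<bar> powr p) \<le> norm (C1 a powr (- p) * \<bar>f x\<bar> powr p)"
      using low C1 by (auto simp: powr_minus field_simps)
  qed
  have I_low: "C1 a powr p * ?I ?h \<le> ?I f"
  proof -
    have "(LINT x:\<Omega>|lebesgue. C1 a powr p * \<bar>?h x\<bar> powr p) \<le> ?I f"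
      by (rule set_integral_mono) (use int_h int_f low in auto)
    then show ?thesis by simp
  qed
  have I_upp: "?I f \<le> C2 a powr p * (?I ?h + ?c * ?\<mu>)"
  proof -
    have "?I f \<le> (LINT x:\<Omega>|lebesgue. C2 a powr p * (\<bar>?h x\<bar> powr p + ?c))"
      by (rule set_integral_mono) (use int_h int_f int_c upp in auto)
    also have "\<dots> = C2 a powr p * (?I ?h + (LINT x:\<Omega>|lebesgue. ?c))"
      using set_integral_add(2)[OF int_h int_c] by simp
    also have "(LINT x:\<Omega>|lebesgue. ?c) = ?c * ?\<mu>"
      by (simp add: set_lebesgue_integral_def)
    finally show ?thesis .
  qed
  have S_low: "C1 a powr p * ?S ?h \<le> ?S f"
  proof -
    have "(\<Sum>x\<leftarrow>\<xi>. C1 a powr p * \<bar>?h x\<bar> powr p) \<le> (\<Sum>x\<leftarrow>\<xi>. \<bar>f x\<bar> powr p)"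
      by (intro sum_list_mono low)
    then show ?thesis
      using len by (simp add: sum_list_const_mult divide_right_mono)
  qed
  have S_upp: "?S f \<le> C2 a powr p * (?S ?h + ?c)"
  proof -
    have "(\<Sum>x\<leftarrow>\<xi>. \<bar>f x\<bar> powr p) \<le> (\<Sum>x\<leftarrow>\<xi>. C2 a powr p * (\<bar>?h x\<bar> powr p + ?c))"
      by (intro sum_list_mono upp)
    also have "\<dots> = C2 a powr p * ((\<Sum>x\<leftarrow>\<xi>. \<bar>?h x\<bar> powr p) + real (length \<xi>) * ?c)"
      by (simp add: sum_list_const_mult sum_list_addf sum_list_triv)
    finally show ?thesis
      using len by (simp add: field_simps)
  qed
  have h: "?I ?h / ?\<mu> - \<sigma> \<le> ?S ?h" "?S ?h \<le> ?I ?h / ?\<mu> + \<sigma>"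
    using h_lower h_upper by (simp_all add: Lp_norm_powr[OF p] sample_norm_powr[OF p])
  \<comment> \<open>Lower estimate: the upper pointwise bound, averaged over
    \<open>\<Omega>\<close>, bounds the mean of \<open>h_fun\<close> from below; the hypothesis
    passes this to the sample mean, and \<open>S_low\<close> returns to \<open>f\<close>.\<close>
  have "C2 a powr (- p) / ?\<mu> * ?I f \<le> ?I ?h / ?\<mu> + ?c"
    using I_upp C2 \<mu> by (simp add: powr_minus field_simps)
  then have "C1 a powr p * (C2 a powr (- p) / ?\<mu> * ?I f - ?c - \<sigma>) \<le> C1 a powr p * ?S ?h"
    using h by (intro mult_left_mono) auto
  \<comment> \<open>Upper estimate, with the roles exchanged: the lower pointwise bound is averaged
    over \<open>\<Omega>\<close> and the upper one over \<open>\<xi>\<close>.\<close>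
  moreover have "?I ?h / ?\<mu> \<le> C1 a powr (- p) / ?\<mu> * ?I f"
    using I_low C1 \<mu> by (simp add: powr_minus field_simps)
  then have "C2 a powr p * (?S ?h + ?c) \<le>
      C2 a powr p * (C1 a powr (- p) / ?\<mu> * ?I f + ?c + \<sigma>)"
    using h by (intro mult_left_mono) auto
  ultimately show ?thesis
    using S_low S_upp unfolding Lp_norm_powr[OF p] sample_norm_powr[OF p] by linarith
qed

end
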